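(* For each infinite cardinal $\kappa$, there exists a $0$-dimensional $T_2$ topological space $X$ such that $X$ is a dense subset (with the subspace topology) of the space $D(2)^{2^\kappa}$, and $$|X|=\Delta(X)=\kappa,\qquad \operatorname{ps}(X)=\log(\kappa),\qquad \operatorname{sm}(X)=2.$$
   Context: $D(2)$ is the discrete two-point space, and $D(2)^{2^\kappa}$ carries the product topology. $\Delta(X)$ is the dispersion character: the minimum cardinality of a nonempty open subset of $X$. For a cardinal $\kappa$, $\log(\kappa)=\min\{\lambda:2^\lambda\ge\kappa\}$ (minimum over cardinals). Games ($X$ a topological space, $Y\subseteq X$, $\beta$ an ordinal): two players, Seeker and Hider, make $\beta$ moves. At move $\alpha<\beta$, knowing all previous moves, the Seeker chooses an open set $U_\alpha\subseteq X$, and then the Hider chooses $V_\alpha\in\{U_\alpha, X\setminus U_\alpha\}$. The outcome is $W=\bigcap_{\alpha<\beta}V_\alpha$ (with $W=X$ if $\beta=0$). In the point separating game $G_\beta(X)$ the Seeker wins iff $|W|\le 1$. In the set membership game $G_\beta(Y,X)$ the Seeker wins iff $W\subseteq Y$ or $W\cap Y=\emptyset$. For a $T_0$ space $X$: $\operatorname{ps}(X)$ is the least ordinal $\beta$ such that the Seeker has a winning strategy in $G_\beta(X)$; $\operatorname{sm}(Y,X)$ is the least ordinal $\beta$ such that the Seeker has a winning strategy in $G_\beta(Y,X)$; $\operatorname{sm}(X)=\sup\{\operatorname{sm}(Y,X):Y\subseteq X\}$. *)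

theory Defs
  imports "HOL-Analysis.Analysis"
begin

unbundle cardinal_syntax

text \<open>
  Cardinals and ordinals are represented, as in the library, by relations: an ordinal is a
  (reflexive) well-order on its field, a cardinal is a well-order that is minimal for its field,
  i.e. an initial ordinal. They are compared by \<open>\<le>o\<close>, \<open><o\<close>, \<open>=o\<close>.
\<close>


section \<open>Cardinal functions\<close>

definition clog :: "'k rel \<Rightarrow> 'k rel" where
  "clog \<kappa> = (SOME \<mu>. Card_order \<mu> \<and> \<kappa> \<le>o ctwo ^c \<mu> \<and>
     (\<forall>\<nu>::'k rel. Card_order \<nu> \<and> \<kappa> \<le>o ctwo ^c \<nu> \<longrightarrow> \<mu> \<le>o \<nu>))"

text \<open>
  Searching \<open>clog \<kappa>\<close> among the cardinals on the type of \<open>\<kappa>\<close> is no restriction, since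
  \<open>\<kappa>\<close> itself is a candidate and every smaller cardinal lives on this type as well.
\<close>

lemma clog:
  fixes \<kappa> :: "'k rel"
  assumes "Card_order \<kappa>"
  shows "Card_order (clog \<kappa>)" and "\<kappa> \<le>o ctwo ^c (clog \<kappa>)"
    and "\<And>\<nu>::'k rel. Card_order \<nu> \<Longrightarrow> \<kappa> \<le>o ctwo ^c \<nu> \<Longrightarrow> clog \<kappa> \<le>o \<nu>"
proof -
  let ?R = "{\<mu>::'k rel. Card_order \<mu> \<and> \<kappa> \<le>o ctwo ^c \<mu>}"
  have "\<kappa> \<in> ?R"
    using assms by (simp add: ordLess_ctwo_cexp ordLess_imp_ordLeq)
  then have "\<exists>\<mu>\<in>?R. \<forall>\<nu>\<in>?R. \<mu> \<le>o \<nu>"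
    by (intro exists_minim_Card_order) auto
  then have "\<exists>\<mu>::'k rel. Card_order \<mu> \<and> \<kappa> \<le>o ctwo ^c \<mu> \<and>
      (\<forall>\<nu>::'k rel. Card_order \<nu> \<and> \<kappa> \<le>o ctwo ^c \<nu> \<longrightarrow> \<mu> \<le>o \<nu>)"
    by blast
  from someI_ex[OF this, folded clog_def]
  show "Card_order (clog \<kappa>)" "\<kappa> \<le>o ctwo ^c (clog \<kappa>)"
    "\<And>\<nu>::'k rel. Card_order \<nu> \<Longrightarrow> \<kappa> \<le>o ctwo ^c \<nu> \<Longrightarrow> clog \<kappa> \<le>o \<nu>"
    by blast+
qed

definition dispersion_character :: "'a topology \<Rightarrow> 'a rel" where
  "dispersion_character T = (SOME \<mu>.
     (\<exists>U. openin T U \<and> U \<noteq> {} \<and> \<mu> = |U| ) \<and>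
     (\<forall>U. openin T U \<and> U \<noteq> {} \<longrightarrow> \<mu> \<le>o |U| ))"

lemma dispersion_character:
  assumes "topspace T \<noteq> {}"
  shows "\<exists>U. openin T U \<and> U \<noteq> {} \<and> dispersion_character T = |U|"
    and "\<And>U. openin T U \<Longrightarrow> U \<noteq> {} \<Longrightarrow> dispersion_character T \<le>o |U|"
proof -
  let ?R = "{ |U| |U. openin T U \<and> U \<noteq> {} }"
  have "|topspace T| \<in> ?R"
    using assms by blast
  then have "\<exists>\<mu>\<in>?R. \<forall>\<nu>\<in>?R. \<mu> \<le>o \<nu>"
    by (intro exists_minim_Card_order) (auto simp: card_of_Card_order)
  then have "\<exists>\<mu>. (\<exists>U. openin T U \<and> U \<noteq> {} \<and> \<mu> = |U| ) \<and>
      (\<forall>U. openin T U \<and> U \<noteq> {} \<longrightarrow> \<mu> \<le>o |U| )"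
    by blast
  from someI_ex[OF this, folded dispersion_character_def]
  show "\<exists>U. openin T U \<and> U \<noteq> {} \<and> dispersion_character T = |U|"
    "\<And>U. openin T U \<Longrightarrow> U \<noteq> {} \<Longrightarrow> dispersion_character T \<le>o |U|"
    by blast+
qed


section \<open>Spaces\<close>

definition zero_dimensional :: "'a topology \<Rightarrow> bool" where
  "zero_dimensional T \<longleftrightarrow>
     (\<exists>\<B>. (\<forall>B\<in>\<B>. openin T B \<and> closedin T B) \<and> openin T = arbitrary union_of (\<lambda>B. B \<in> \<B>))"

lemma zero_dimensional_iff_dim_le: "zero_dimensional T \<longleftrightarrow> T dim_le 0"
proof
  assume "zero_dimensional T"
  then obtain \<B> where \<B>: "\<And>B. B \<in> \<B> \<Longrightarrow> closedin T B \<and> openin T B"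
    and base: "neighbourhood_base_of (\<lambda>B. B \<in> \<B>) T"
    unfolding zero_dimensional_def openin_topology_neighbourhood_base_unique by blast
  then show "T dim_le 0"
    unfolding dimension_le_0_neighbourhood_base_of_clopen
    by (rule_tac neighbourhood_base_of_mono[OF base]) blast
next
  assume "T dim_le 0"
  then have "neighbourhood_base_of (\<lambda>B. B \<in> {B. closedin T B \<and> openin T B}) T"
    by (simp add: dimension_le_0_neighbourhood_base_of_clopen)
  then show "zero_dimensional T"
    unfolding zero_dimensional_def openin_topology_neighbourhood_base_unique
    by (intro exI[of _ "{B. closedin T B \<and> openin T B}"]) simp
qed

text \<open>The power \<open>D(2)\<^sup>I\<close>; its points are the functions in \<open>I \<rightarrow>\<^sub>E UNIV\<close>.\<close>

definition cantor_cube :: "'i set \<Rightarrow> ('i \<Rightarrow> bool) topology" where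
  "cantor_cube I = product_topology (\<lambda>_. discrete_topology UNIV) I"


section \<open>Games\<close>

text \<open>
  A game of length \<open>\<beta>\<close> has one move for each \<open>\<alpha> \<in> Field \<beta>\<close>. A strategy of the Seeker maps
  a move \<open>\<alpha>\<close> and the sets \<open>(U\<^sub>\<gamma>, V\<^sub>\<gamma>)\<close> played at all moves \<open>\<gamma>\<close> strictly before \<open>\<alpha>\<close>
  (the history, restricted to \<open>underS \<beta> \<alpha>\<close>) to the set \<open>U\<^sub>\<alpha>\<close>.
\<close>

definition play_outcome :: "'b rel \<Rightarrow> 'a topology \<Rightarrow> ('b \<Rightarrow> 'a set) \<Rightarrow> 'a set" where
  "play_outcome \<beta> T V = topspace T \<inter> (\<Inter>\<alpha>\<in>Field \<beta>. V \<alpha>)"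

definition seeker_wins :: "'b rel \<Rightarrow> 'a topology \<Rightarrow> ('a set \<Rightarrow> bool) \<Rightarrow> bool" where
  "seeker_wins \<beta> T Win \<longleftrightarrow>
     (\<exists>\<sigma> :: 'b \<Rightarrow> ('b \<Rightarrow> 'a set \<times> 'a set) \<Rightarrow> 'a set.
        (\<forall>\<alpha>\<in>Field \<beta>. \<forall>h. openin T (\<sigma> \<alpha> h)) \<and>
        (\<forall>U V. (\<forall>\<alpha>\<in>Field \<beta>. U \<alpha> = \<sigma> \<alpha> (restrict (\<lambda>\<gamma>. (U \<gamma>, V \<gamma>)) (underS \<beta> \<alpha>)) \<and>
                             V \<alpha> \<in> {U \<alpha>, topspace T - U \<alpha>})
               \<longrightarrow> Win (play_outcome \<beta> T V)))"

definition seeker_wins_ps :: "'b rel \<Rightarrow> 'a topology \<Rightarrow> bool" where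
  "seeker_wins_ps \<beta> T \<longleftrightarrow> seeker_wins \<beta> T (\<lambda>W. finite W \<and> card W \<le> 1)"

definition seeker_wins_sm :: "'b rel \<Rightarrow> 'a set \<Rightarrow> 'a topology \<Rightarrow> bool" where
  "seeker_wins_sm \<beta> Y T \<longleftrightarrow> seeker_wins \<beta> T (\<lambda>W. W \<subseteq> Y \<or> W \<inter> Y = {})"

text \<open>
  The least ordinal with a property. Quantifying \<open>\<gamma>\<close> over the type of \<open>\<beta>\<close> only is no
  restriction for isomorphism-invariant properties: every ordinal below \<open>\<beta>\<close> has a copy there.
\<close>

definition least_ordinal :: "('b rel \<Rightarrow> bool) \<Rightarrow> 'b rel \<Rightarrow> bool" where
  "least_ordinal P \<beta> \<longleftrightarrow> Well_order \<beta> \<and> P \<beta> \<and> (\<forall>\<gamma>. Well_order \<gamma> \<and> P \<gamma> \<longrightarrow> \<beta> \<le>o \<gamma>)"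

text \<open>
  Relational forms of \<open>ps(X) = \<beta>\<close>, \<open>sm(Y,X) = \<beta>\<close> and \<open>sm(X) = \<beta>\<close>, which make sense for
  ordinals \<open>\<beta>\<close> on any type. The last one says that \<open>\<beta>\<close> is the least upper bound of the
  ordinals \<open>sm(Y,X)\<close>.
\<close>

definition has_ps :: "'a topology \<Rightarrow> 'b rel \<Rightarrow> bool" where
  "has_ps T \<beta> \<longleftrightarrow> least_ordinal (\<lambda>\<gamma>. seeker_wins_ps \<gamma> T) \<beta>"

definition has_sm_in :: "'a set \<Rightarrow> 'a topology \<Rightarrow> 'b rel \<Rightarrow> bool" where
  "has_sm_in Y T \<beta> \<longleftrightarrow> least_ordinal (\<lambda>\<gamma>. seeker_wins_sm \<gamma> Y T) \<beta>"

definition has_sm :: "'a topology \<Rightarrow> 'b rel \<Rightarrow> bool" where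
  "has_sm T \<beta> \<longleftrightarrow>
     least_ordinal (\<lambda>\<gamma>. \<forall>Y\<subseteq>topspace T. \<exists>\<delta>::'b rel. has_sm_in Y T \<delta> \<and> \<delta> \<le>o \<gamma>) \<beta>"

end

theory Submission
  imports Defs "HOL-Algebra.Free_Abelian_Groups"
begin

text \<open>
  A set of \<open>\<kappa>\<close> points in the power of \<open>D(2)\<close> with \<open>2 ^ \<kappa>\<close> factors amounts to a family of \<open>2 ^ \<kappa>\<close>
  subsets of \<open>\<kappa>\<close>, and it is dense if the family is independent. Start with an independent family whose
  finite Boolean combinations have size \<open>\<kappa>\<close>, and take an ideal that contains the sets of size below
  \<open>\<kappa>\<close> and is maximal among those containing no such combination. By maximality every set
  outside the ideal contains a combination modulo the ideal. Now modify the members of the family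
  within the ideal so that each set of the ideal becomes closed. In the resulting space every set
  is the union of its interior and a closed set. Two moves of the Seeker therefore decide
  membership in any given set, and \<open>2 log \<kappa> = log \<kappa>\<close> moves decide membership in \<open>log \<kappa>\<close> sets
  separating the points.
\<close>

section \<open>An independent family and a maximal ideal\<close>

definition cell :: "'a set \<Rightarrow> ('i \<Rightarrow> 'a set) \<Rightarrow> 'i set \<Rightarrow> 'i set \<Rightarrow> 'a set" where
  "cell K B P Q = {x\<in>K. (\<forall>i\<in>P. x \<in> B i) \<and> (\<forall>i\<in>Q. x \<notin> B i)}"

definition disjoint_pairs :: "'i set \<Rightarrow> ('i set \<times> 'i set) set" where
  "disjoint_pairs I = {(P, Q). finite P \<and> finite Q \<and> P \<subseteq> I \<and> Q \<subseteq> I \<and> P \<inter> Q = {}}"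

text \<open>Hausdorff's independent family: the points of \<open>K\<close> code pairs \<open>(F, S)\<close> of a finite set
  \<open>F \<subseteq> K\<close> and a finite set \<open>S\<close> of finite subsets of \<open>K\<close>, and \<open>i\<close> owns the pairs with
  \<open>{k\<in>F. i k} \<in> S\<close>.\<close>

lemma ex_independent_family:
  assumes "infinite K"
  shows "\<exists>B :: ('k \<Rightarrow> bool) \<Rightarrow> 'k set. \<forall>(P, Q) \<in> disjoint_pairs (Func K UNIV). |K| \<le>o |cell K B P Q|"
proof -
  have "infinite (Fpow K)"
    using eqpoll_Fpow[OF assms] assms eqpoll_finite_iff by blast
  then have "Fpow (Fpow K) \<approx> K"
    by (rule eqpoll_trans[OF eqpoll_Fpow eqpoll_Fpow[OF assms]])
  then have "Fpow K \<times> Fpow (Fpow K) \<approx> K \<times> K"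
    by (intro times_eqpoll_cong eqpoll_Fpow assms)
  also have "K \<times> K \<approx> K"
    using card_of_Times_same_infinite[OF assms] by (auto simp: eqpoll_iff_card_of_ordIso)
  finally obtain b where b: "bij_betw b (Fpow K \<times> Fpow (Fpow K)) K"
    by (auto simp: eqpoll_def)
  define tr where "tr F i = {k\<in>F. i k}" for F :: "'k set" and i
  define B where "B i = b ` {(F, S) \<in> Fpow K \<times> Fpow (Fpow K). tr F i \<in> S}" for i
  have B: "b (F, S) \<in> B i \<longleftrightarrow> tr F i \<in> S" if "F \<in> Fpow K" "S \<in> Fpow (Fpow K)" for F S i
    unfolding B_def using that bij_betw_imp_inj_on[OF b] by (auto simp: inj_on_def)
  have "|K| \<le>o |cell K B P Q|"
    if PQ: "finite P" "finite Q" "P \<subseteq> Func K UNIV" "Q \<subseteq> Func K UNIV" "P \<inter> Q = {}" for P Q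
  proof -
    \<comment> \<open>Elements of \<open>Func K UNIV\<close> agree off \<open>K\<close>, so distinct
      ones differ at some point of \<open>K\<close>.\<close>
    have "\<exists>k\<in>K. i k \<noteq> j k" if "i \<in> P" "j \<in> Q" for i j
    proof (rule ccontr)
      assume "\<not> (\<exists>k\<in>K. i k \<noteq> j k)"
      moreover have "i k = j k" if "k \<notin> K" for k
        using that \<open>i \<in> P\<close> \<open>j \<in> Q\<close> PQ by (auto simp: Func_def)
      ultimately have "i = j" by blast
      then show False using that PQ by auto
    qed
    then obtain d where d: "\<And>i j. i \<in> P \<Longrightarrow> j \<in> Q \<Longrightarrow> d i j \<in> K \<and> i (d i j) \<noteq> j (d i j)"
      by metis
    \<comment> \<open>On any set containing \<open>F\<^sub>0\<close>, no member of \<open>P\<close>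
      has the same trace as a member of \<open>Q\<close>.\<close>
    define F\<^sub>0 where "F\<^sub>0 = (\<lambda>(i, j). d i j) ` (P \<times> Q)"
    have F0: "finite F\<^sub>0" "F\<^sub>0 \<subseteq> K"
      unfolding F\<^sub>0_def using PQ d by auto
    have Fin: "insert k F\<^sub>0 \<in> Fpow K" "tr (insert k F\<^sub>0) ` P \<in> Fpow (Fpow K)" if "k \<in> K" for k
    proof -
      show "insert k F\<^sub>0 \<in> Fpow K"
        using that F0 by (auto simp: Fpow_def)
      have "tr (insert k F\<^sub>0) i \<in> Fpow K" for i
        using that F0 by (auto simp: Fpow_def tr_def)
      then show "tr (insert k F\<^sub>0) ` P \<in> Fpow (Fpow K)"
        using PQ by (auto simp: Fpow_def[of "Fpow K"])
    qed
    \<comment> \<open>A code whose second part is the set of traces of \<open>P\<close> lies in the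
      cell. Letting \<open>k\<close> range outside \<open>F\<^sub>0\<close> gives \<open>|K|\<close>
      such codes.\<close>
    define g where "g k = b (insert k F\<^sub>0, tr (insert k F\<^sub>0) ` P)" for k
    have "tr (insert k F\<^sub>0) j \<noteq> tr (insert k F\<^sub>0) i" if "i \<in> P" "j \<in> Q" for i j k
    proof -
      have "d i j \<in> F\<^sub>0" using that by (auto simp: F\<^sub>0_def)
      then show ?thesis using d[OF that] by (auto simp: tr_def)
    qed
    then have "g k \<in> cell K B P Q" if "k \<in> K" for k
      using B[OF Fin[OF that]] bij_betw_apply[OF b, of "(insert k F\<^sub>0, tr (insert k F\<^sub>0) ` P)"] Fin[OF that]
      by (auto simp: cell_def g_def)
    moreover have "inj_on g (K - F\<^sub>0)"
    proof (rule inj_onI)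
      fix k l assume kl: "k \<in> K - F\<^sub>0" "l \<in> K - F\<^sub>0" "g k = g l"
      then have "(insert k F\<^sub>0, tr (insert k F\<^sub>0) ` P) = (insert l F\<^sub>0, tr (insert l F\<^sub>0) ` P)"
        using Fin by (intro inj_onD[OF bij_betw_imp_inj_on[OF b]]) (auto simp: g_def)
      then show "k = l" using kl by auto
    qed
    ultimately have "|K - F\<^sub>0| \<le>o |cell K B P Q|"
      by (intro card_of_ordLeqI[where f=g]) auto
    moreover have "|K| =o |K - F\<^sub>0|"
      using card_of_infinite_diff_finite[OF assms F0(1)] ordIso_symmetric by blast
    ultimately show ?thesis
      using ordIso_ordLeq_trans by blast
  qed
  then show ?thesis by (intro exI[of _ B]) (auto simp: disjoint_pairs_def)
qed

section \<open>Ideals that are maximal among those avoiding given sets\<close>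

definition ideal_on :: "'a set \<Rightarrow> 'a set set \<Rightarrow> bool" where
  "ideal_on K J \<longleftrightarrow> J \<subseteq> Pow K \<and> {} \<in> J \<and> (\<forall>M N. M \<in> J \<and> N \<subseteq> M \<longrightarrow> N \<in> J) \<and>
     (\<forall>M\<in>J. \<forall>N\<in>J. M \<union> N \<in> J)"

lemma ideal_onI:
  assumes "J \<subseteq> Pow K" "{} \<in> J" "\<And>M N. M \<in> J \<Longrightarrow> N \<subseteq> M \<Longrightarrow> N \<in> J"
    "\<And>M N. M \<in> J \<Longrightarrow> N \<in> J \<Longrightarrow> M \<union> N \<in> J"
  shows "ideal_on K J"
  unfolding ideal_on_def using assms by blast

lemma ideal_onD:
  assumes "ideal_on K J"
  shows "J \<subseteq> Pow K" "{} \<in> J" "\<And>M N. M \<in> J \<Longrightarrow> N \<subseteq> M \<Longrightarrow> N \<in> J"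
    "\<And>M N. M \<in> J \<Longrightarrow> N \<in> J \<Longrightarrow> M \<union> N \<in> J"
  using assms unfolding ideal_on_def by blast+

text \<open>An ideal that is maximal among those avoiding all cells makes the cells dense in the
  quotient algebra: otherwise it could be enlarged by \<open>Y\<close>.\<close>

lemma ex_maximal_avoiding_ideal:
  assumes "ideal_on K J\<^sub>0" and "J\<^sub>0 \<inter> \<C> = {}"
  shows "\<exists>J. ideal_on K J \<and> J\<^sub>0 \<subseteq> J \<and> J \<inter> \<C> = {} \<and> (\<forall>Y\<subseteq>K. Y \<notin> J \<longrightarrow> (\<exists>C\<in>\<C>. C - Y \<in> J))"
proof -
  let ?A = "{J. ideal_on K J \<and> J\<^sub>0 \<subseteq> J \<and> J \<inter> \<C> = {}}"
  have "\<exists>M\<in>?A. \<forall>X\<in>?A. M \<subseteq> X \<longrightarrow> X = M"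
  proof (rule subset_Zorn_nonempty)
    show "?A \<noteq> {}" using assms by blast
    fix \<D> assume ne: "\<D> \<noteq> {}" and ch: "subset.chain ?A \<D>"
    then have D: "\<And>J. J \<in> \<D> \<Longrightarrow> ideal_on K J \<and> J\<^sub>0 \<subseteq> J \<and> J \<inter> \<C> = {}"
      and lin: "\<And>J J'. J \<in> \<D> \<Longrightarrow> J' \<in> \<D> \<Longrightarrow> J \<subseteq> J' \<or> J' \<subseteq> J"
      unfolding subset_chain_def by auto
    have "ideal_on K (\<Union>\<D>)"
    proof (rule ideal_onI)
      show "\<Union>\<D> \<subseteq> Pow K"
        using D by (intro Union_least) (simp add: ideal_onD)
      from ne obtain J where "J \<in> \<D>" by blast
      with D show "{} \<in> \<Union>\<D>" by (meson UnionI ideal_onD(2))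
      show "N \<in> \<Union>\<D>" if "M \<in> \<Union>\<D>" "N \<subseteq> M" for M N
        using that D by (meson UnionE UnionI ideal_onD(3))
      fix M N assume "M \<in> \<Union>\<D>" "N \<in> \<Union>\<D>"
      then obtain J J' where J: "J \<in> \<D>" "M \<in> J" "J' \<in> \<D>" "N \<in> J'"
        by (elim UnionE)
      then have "M \<in> J' \<and> N \<in> J' \<or> M \<in> J \<and> N \<in> J" using lin by blast
      then show "M \<union> N \<in> \<Union>\<D>" using J D by (meson UnionI ideal_onD(4))
    qed
    moreover have "J\<^sub>0 \<subseteq> \<Union>\<D>" "\<Union>\<D> \<inter> \<C> = {}"
      using D ne by blast+
    ultimately show "\<Union>\<D> \<in> ?A" by blast
  qed
  then obtain J where J: "ideal_on K J" "J\<^sub>0 \<subseteq> J" "J \<inter> \<C> = {}"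
    and max': "\<forall>X\<in>?A. J \<subseteq> X \<longrightarrow> X = J"
    by auto
  have max: "J' = J" if "ideal_on K J'" "J \<subseteq> J'" "J' \<inter> \<C> = {}" for J'
    using that max' J by auto
  have "\<exists>C\<in>\<C>. C - Y \<in> J" if Y: "Y \<subseteq> K" "Y \<notin> J" for Y
  proof -
    \<comment> \<open>This is the ideal generated by \<open>J\<close> and \<open>Y\<close>. If it
      avoided \<open>\<C>\<close>, it would equal \<open>J\<close> by maximality, although it
      contains \<open>Y\<close>.\<close>
    let ?J = "{Z. Z \<subseteq> K \<and> Z - Y \<in> J}"
    have "ideal_on K ?J"
    proof (rule ideal_onI)
      show "{} \<in> ?J" using ideal_onD(2)[OF J(1)] by simp
      show "M \<union> N \<in> ?J" if "M \<in> ?J" "N \<in> ?J" for M N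
        using that ideal_onD(4)[OF J(1), of "M - Y" "N - Y"] by (simp add: Un_Diff)
      show "N \<in> ?J" if "M \<in> ?J" "N \<subseteq> M" for M N
        using that ideal_onD(3)[OF J(1), of "M - Y" "N - Y"] by auto
    qed auto
    moreover have "J \<subseteq> ?J"
    proof
      fix Z assume "Z \<in> J"
      then show "Z \<in> ?J"
        using ideal_onD(1)[OF J(1)] ideal_onD(3)[OF J(1), of Z "Z - Y"] by auto
    qed
    moreover have "Y \<in> ?J"
      using Y ideal_onD(2)[OF J(1)] by simp
    ultimately have "?J \<inter> \<C> \<noteq> {}" using max[of ?J] Y(2) by metis
    then show ?thesis by auto
  qed
  with J show ?thesis by (intro exI[of _ J] conjI) auto
qed

section \<open>Families modified within an ideal\<close>

lemma ideal_on_UN: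
  assumes "ideal_on K J" "finite F" "\<And>i. i \<in> F \<Longrightarrow> D i \<in> J"
  shows "(\<Union>i\<in>F. D i) \<in> J"
  using assms(2,3) by (induction F) (simp_all add: ideal_onD[OF assms(1)])

text \<open>The properties on which the space is built. \<open>cell_notin\<close> gives density and,
  with \<open>small\<close>, large open sets; \<open>closing\<close> makes the sets of
  \<open>J\<close> closed; \<open>cell_dense\<close> then puts every set with empty interior into
  \<open>J\<close>. The cell of two empty sets is \<open>K\<close>, so \<open>J\<close> is
  proper.\<close>

locale closing_family =
  fixes K :: "'a set" and I :: "'i set" and B :: "'i \<Rightarrow> 'a set" and J :: "'a set set"
  assumes infinite_K: "infinite K"
    and ideal: "ideal_on K J"
    and small: "S \<subseteq> K \<Longrightarrow> |S| <o |K| \<Longrightarrow> S \<in> J"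
    and cell_notin: "(P, Q) \<in> disjoint_pairs I \<Longrightarrow> cell K B P Q \<notin> J"
    and cell_dense: "Y \<subseteq> K \<Longrightarrow> Y \<notin> J \<Longrightarrow> \<exists>(P, Q)\<in>disjoint_pairs I. cell K B P Q - Y \<in> J"
    and closing: "N \<in> J \<Longrightarrow> x \<in> K \<Longrightarrow> \<exists>i\<in>I. x \<in> B i \<and> B i \<inter> N \<subseteq> {x}"

text \<open>Each pair \<open>(N, x)\<close> with \<open>N\<close> in the ideal gets its own index \<open>i\<close>, and \<open>B i\<close> is changed on a
  set of the ideal so that it becomes a neighbourhood of \<open>x\<close> missing \<open>N - {x}\<close>. Modulo the ideal
  nothing changes.\<close>

lemma ex_closing_family:
  fixes K :: "'k set"
  assumes K: "infinite K"
  shows "\<exists>B J. closing_family K (Func K (UNIV :: bool set)) B J"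
proof -
  define I where "I = Func K (UNIV :: bool set)"
  obtain B\<^sub>0 :: "('k \<Rightarrow> bool) \<Rightarrow> 'k set"
    where B0: "\<forall>(P, Q)\<in>disjoint_pairs I. |K| \<le>o |cell K B\<^sub>0 P Q|"
    using ex_independent_family[OF K] unfolding I_def by (elim exE)
  define \<C> where "\<C> = (\<lambda>(P, Q). cell K B\<^sub>0 P Q) ` disjoint_pairs I"
  define J\<^sub>0 where "J\<^sub>0 = {S. S \<subseteq> K \<and> |S| <o |K|}"
  have "ideal_on K J\<^sub>0"
  proof (rule ideal_onI)
    show "{} \<in> J\<^sub>0"
      using finite_ordLess_infinite2[of "{}" K] K by (simp add: J\<^sub>0_def)
    show "N \<in> J\<^sub>0" if "M \<in> J\<^sub>0" "N \<subseteq> M" for M N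
      using that ordLeq_ordLess_trans[OF card_of_mono1[of N M]] by (auto simp: J\<^sub>0_def)
    show "M \<union> N \<in> J\<^sub>0" if "M \<in> J\<^sub>0" "N \<in> J\<^sub>0" for M N
      using that card_of_Un_ordLess_infinite[OF K, of M N] by (simp add: J\<^sub>0_def)
  qed (auto simp: J\<^sub>0_def)
  moreover have "J\<^sub>0 \<inter> \<C> = {}"
  proof -
    have "\<not> |cell K B\<^sub>0 P Q| <o |K|" if "(P, Q) \<in> disjoint_pairs I" for P Q
      using bspec[OF B0 that] not_ordLess_ordLeq by auto
    then have "cell K B\<^sub>0 P Q \<notin> J\<^sub>0" if "(P, Q) \<in> disjoint_pairs I" for P Q
      using that by (simp add: J\<^sub>0_def)
    then show ?thesis by (auto simp: \<C>_def)
  qed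
  ultimately have "\<exists>J. ideal_on K J \<and> J\<^sub>0 \<subseteq> J \<and> J \<inter> \<C> = {} \<and> (\<forall>Y\<subseteq>K. Y \<notin> J \<longrightarrow> (\<exists>C\<in>\<C>. C - Y \<in> J))"
    by (rule ex_maximal_avoiding_ideal)
  then obtain J where J: "ideal_on K J" "J\<^sub>0 \<subseteq> J" "J \<inter> \<C> = {}"
    and dense: "\<forall>Y\<subseteq>K. Y \<notin> J \<longrightarrow> (\<exists>C\<in>\<C>. C - Y \<in> J)"
    by (elim exE conjE)
  note JD = ideal_onD[OF J(1)]
  have fin: "F \<in> J" if "finite F" "F \<subseteq> K" for F
    using that J(2) finite_ordLess_infinite2[OF _ K, of F] by (auto simp: J\<^sub>0_def)
  \<comment> \<open>Counting: there are as many pairs in \<open>Pow K \<times> K\<close> as indices,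
    so the two can be matched.\<close>
  have "|K| \<le>o |Pow K|"
    by (rule ordLess_imp_ordLeq[OF card_of_Pow])
  then have "|Pow K \<times> K| =o |Pow K|"
    using K by (intro card_of_Times_infinite_simps(1)) auto
  then have "|Pow K \<times> K| =o |I|"
    unfolding I_def using card_of_Pow_Func by (rule ordIso_transitive)
  then have "|I| =o |Pow K \<times> K|"
    by (rule ordIso_symmetric)
  then obtain pr where pr: "bij_betw pr I (Pow K \<times> K)"
    by (auto simp: card_of_ordIso[symmetric])
  define N where "N i = fst (pr i)" for i
  define p where "p i = snd (pr i)" for i
  define B where "B i = (if N i \<in> J then insert (p i) (B\<^sub>0 i) - (N i - {p i}) else B\<^sub>0 i)" for i
  define D where "D i = (if N i \<in> J then insert (p i) (N i) else {})" for i
  have D: "D i \<in> J" if "i \<in> I" for i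
  proof -
    have "p i \<in> K"
      using bij_betwE[OF pr] that by (auto simp: p_def mem_Times_iff)
    then have "{p i} \<union> N i \<in> J" if "N i \<in> J"
      by (intro JD(4)[OF fin that]) simp_all
    then show ?thesis by (simp add: D_def JD(2))
  qed
  have BB: "x \<in> B i \<longleftrightarrow> x \<in> B\<^sub>0 i" if "x \<notin> D i" for x i
    using that by (auto simp: B_def D_def split: if_splits)
  \<comment> \<open>A cell involves finitely many indices, so its versions for \<open>B\<close> and
    \<open>B\<^sub>0\<close> differ only on a set of \<open>J\<close>. Both properties of the cells
    therefore survive the modification.\<close>
  have UD: "(\<Union>i\<in>P \<union> Q. D i) \<in> J" if "(P, Q) \<in> disjoint_pairs I" for P Q
    using that by (intro ideal_on_UN[OF J(1)] D) (auto simp: disjoint_pairs_def)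
  have cells: "x \<in> cell K B P Q \<longleftrightarrow> x \<in> cell K B\<^sub>0 P Q" if "x \<notin> (\<Union>i\<in>P \<union> Q. D i)" for x P Q
    using that BB by (auto simp: cell_def)
  have "closing_family K I B J"
  proof
    show "infinite K" "ideal_on K J" by fact+
    show "S \<in> J" if "S \<subseteq> K" "|S| <o |K|" for S
      using that J(2) by (auto simp: J\<^sub>0_def)
    show "cell K B P Q \<notin> J" if PQ: "(P, Q) \<in> disjoint_pairs I" for P Q
    proof
      assume "cell K B P Q \<in> J"
      then have "cell K B P Q \<union> (\<Union>i\<in>P \<union> Q. D i) \<in> J"
        by (intro JD(4) UD PQ)
      moreover have "cell K B\<^sub>0 P Q \<subseteq> cell K B P Q \<union> (\<Union>i\<in>P \<union> Q. D i)"
        using cells[of _ P Q] by blast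
      ultimately have "cell K B\<^sub>0 P Q \<in> J" by (rule JD(3))
      moreover have "cell K B\<^sub>0 P Q \<in> \<C>"
        using PQ by (force simp: \<C>_def)
      ultimately show False using J(3) by auto
    qed
    show "\<exists>(P, Q)\<in>disjoint_pairs I. cell K B P Q - Y \<in> J" if Y: "Y \<subseteq> K" "Y \<notin> J" for Y
    proof -
      obtain P Q where PQ: "(P, Q) \<in> disjoint_pairs I" "cell K B\<^sub>0 P Q - Y \<in> J"
        using dense[rule_format, OF Y] by (auto simp: \<C>_def)
      then have "(cell K B\<^sub>0 P Q - Y) \<union> (\<Union>i\<in>P \<union> Q. D i) \<in> J"
        by (intro JD(4) UD)
      moreover have "cell K B P Q - Y \<subseteq> (cell K B\<^sub>0 P Q - Y) \<union> (\<Union>i\<in>P \<union> Q. D i)"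
        using cells[of _ P Q] by blast
      ultimately have "cell K B P Q - Y \<in> J" by (rule JD(3))
      with PQ(1) show ?thesis by auto
    qed
    show "\<exists>i\<in>I. x \<in> B i \<and> B i \<inter> M \<subseteq> {x}" if "M \<in> J" "x \<in> K" for M x
    proof -
      have "(M, x) \<in> pr ` I"
        using that JD(1) bij_betw_imp_surj_on[OF pr] by auto
      then obtain i where i: "i \<in> I" "pr i = (M, x)" by auto
      then show ?thesis
        using that by (intro bexI[of _ i]) (auto simp: B_def N_def p_def)
    qed
  qed
  then show ?thesis unfolding I_def by (intro exI)
qed


section \<open>Games\<close>

text \<open>The Seeker may ignore the history; both winning strategies constructed below do
  so.\<close>

lemma seeker_wins_nonadaptive:
  assumes "\<And>\<alpha>. \<alpha> \<in> Field \<beta> \<Longrightarrow> openin T (A \<alpha>)"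
    and "\<And>V. (\<And>\<alpha>. \<alpha> \<in> Field \<beta> \<Longrightarrow> V \<alpha> \<in> {A \<alpha>, topspace T - A \<alpha>}) \<Longrightarrow> Win (play_outcome \<beta> T V)"
  shows "seeker_wins \<beta> T Win"
  unfolding seeker_wins_def
proof (intro exI[of _ "\<lambda>\<alpha> _. A \<alpha>"] conjI allI impI ballI)
  fix U V :: "'a \<Rightarrow> 'b set"
  assume "\<forall>\<alpha>\<in>Field \<beta>. U \<alpha> = A \<alpha> \<and> V \<alpha> \<in> {U \<alpha>, topspace T - U \<alpha>}"
  then show "Win (play_outcome \<beta> T V)"
    using assms(2)[of V] by auto
qed (use assms(1) in auto)

text \<open>The Hider can keep any prescribed point \<open>x\<close> in the outcome, and the bits telling whether
  \<open>x \<in> U\<^sub>\<alpha>\<close> determine the whole play; so at most \<open>2 ^ |\<beta>|\<close> points can be separated.\<close>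

lemma card_le_if_seeker_wins_ps:
  assumes \<beta>: "Well_order \<beta>" and win: "seeker_wins_ps \<beta> T"
  shows "|topspace T| \<le>o ctwo ^c |Field \<beta>|"
proof -
  from win obtain \<sigma> where op: "\<forall>\<alpha>\<in>Field \<beta>. \<forall>h. openin T (\<sigma> \<alpha> h)"
    and \<sigma>: "\<forall>U V. (\<forall>\<alpha>\<in>Field \<beta>. U \<alpha> = \<sigma> \<alpha> (restrict (\<lambda>\<gamma>. (U \<gamma>, V \<gamma>)) (underS \<beta> \<alpha>)) \<and>
       V \<alpha> \<in> {U \<alpha>, topspace T - U \<alpha>}) \<longrightarrow> finite (play_outcome \<beta> T V) \<and> card (play_outcome \<beta> T V) \<le> 1"
    unfolding seeker_wins_ps_def seeker_wins_def by (elim exE conjE)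
  have win: "finite (play_outcome \<beta> T V) \<and> card (play_outcome \<beta> T V) \<le> 1"
    if "\<And>\<alpha>. \<alpha> \<in> Field \<beta> \<Longrightarrow> U \<alpha> = \<sigma> \<alpha> (restrict (\<lambda>\<gamma>. (U \<gamma>, V \<gamma>)) (underS \<beta> \<alpha>)) \<and>
       V \<alpha> \<in> {U \<alpha>, topspace T - U \<alpha>}" for U V
    by (rule \<sigma>[rule_format, of U V]) (rule that)
  have wf: "wf (\<beta> - Id)"
    using \<beta> by (simp add: well_order_on_def)
  \<comment> \<open>The play in which the Hider always keeps the side containing \<open>x\<close>,
    by recursion on the moves; each entry is the pair of the sets chosen by Seeker and
    Hider.\<close>
  define run where "run x = wfrec (\<beta> - Id)
      (\<lambda>h \<alpha>. (\<sigma> \<alpha> h, if x \<in> \<sigma> \<alpha> h then \<sigma> \<alpha> h else topspace T - \<sigma> \<alpha> h))" for x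
  \<comment> \<open>Both functions are \<open>undefined\<close> off the earlier moves, so the
    recursion sees exactly the history that a strategy receives.\<close>
  have cut: "cut f (\<beta> - Id) \<alpha> = restrict f (underS \<beta> \<alpha>)" for f :: "'a \<Rightarrow> 'b set \<times> 'b set" and \<alpha>
    by (auto simp: cut_def underS_def fun_eq_iff)
  have run: "run x \<alpha> = (\<sigma> \<alpha> (restrict (run x) (underS \<beta> \<alpha>)),
      if x \<in> \<sigma> \<alpha> (restrict (run x) (underS \<beta> \<alpha>)) then \<sigma> \<alpha> (restrict (run x) (underS \<beta> \<alpha>))
      else topspace T - \<sigma> \<alpha> (restrict (run x) (underS \<beta> \<alpha>)))" for x \<alpha>
    by (subst run_def, subst wfrec[OF wf], fold run_def, simp add: cut)
  define bits where "bits x \<alpha> = (if \<alpha> \<in> Field \<beta> then x \<in> fst (run x \<alpha>) else undefined)" for x \<alpha>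
  have "inj_on bits (topspace T)"
  proof (rule inj_onI)
    fix x y assume xy: "x \<in> topspace T" "y \<in> topspace T" and eq: "bits x = bits y"
    \<comment> \<open>Equal histories lead to the same open set, and equal bits then lead to the
      same reply.\<close>
    have same: "\<alpha> \<in> Field \<beta> \<longrightarrow> run x \<alpha> = run y \<alpha>" for \<alpha>
      using wf
    proof (induction \<alpha> rule: wf_induct_rule)
      case (less \<alpha>)
      have h: "restrict (run x) (underS \<beta> \<alpha>) = restrict (run y) (underS \<beta> \<alpha>)"
        using less by (intro restrict_ext) (auto simp: underS_def Field_def)
      show ?case
      proof
        assume "\<alpha> \<in> Field \<beta>"
        with eq have "x \<in> fst (run x \<alpha>) \<longleftrightarrow> y \<in> fst (run y \<alpha>)"
          by (auto simp: bits_def fun_eq_iff split: if_splits)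
        then have "x \<in> \<sigma> \<alpha> (restrict (run y) (underS \<beta> \<alpha>)) \<longleftrightarrow> y \<in> \<sigma> \<alpha> (restrict (run y) (underS \<beta> \<alpha>))"
          using run[of x \<alpha>] run[of y \<alpha>] h by simp
        then show "run x \<alpha> = run y \<alpha>"
          using run[of x \<alpha>] run[of y \<alpha>] h by simp
      qed
    qed
    let ?W = "play_outcome \<beta> T (snd \<circ> run x)"
    have mem: "z \<in> play_outcome \<beta> T (snd \<circ> run z)" if "z \<in> topspace T" for z
      using that by (auto simp: play_outcome_def run[of z])
    have "play_outcome \<beta> T (snd \<circ> run y) = ?W"
      using same by (auto simp: play_outcome_def)
    \<comment> \<open>Both points survive the common play, which the Seeker wins.\<close>
    with mem xy have "{x, y} \<subseteq> ?W" by auto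
    moreover have "finite ?W \<and> card ?W \<le> 1"
    proof (rule win[of "fst \<circ> run x"])
      fix \<alpha>
      show "(fst \<circ> run x) \<alpha> = \<sigma> \<alpha> (\<lambda>\<gamma>\<in>underS \<beta> \<alpha>. ((fst \<circ> run x) \<gamma>, (snd \<circ> run x) \<gamma>)) \<and>
        (snd \<circ> run x) \<alpha> \<in> {(fst \<circ> run x) \<alpha>, topspace T - (fst \<circ> run x) \<alpha>}"
        using run[of x \<alpha>] by simp
    qed
    ultimately have "card {x, y} \<le> 1"
      using card_mono le_trans by blast
    then show "x = y" by (cases "x = y") auto
  qed
  moreover have "bits ` topspace T \<subseteq> Func (Field \<beta>) UNIV"
    by (auto simp: bits_def Func_def)
  ultimately show ?thesis
    unfolding cexp_def ctwo_def Field_card_of by (intro card_of_ordLeqI[where f=bits]) auto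
qed

text \<open>If the move is \<open>G\<close>, then \<open>G\<close> and its complement each lie
  inside \<open>Y\<close> or miss \<open>Y\<close>, which leaves only four possibilities for
  \<open>Y\<close>. The bound on \<open>Field \<delta>\<close> also admits the game without moves,
  which decides only the empty set and the whole space.\<close>

lemma clopen_if_single_move:
  assumes Y: "Y \<subseteq> topspace T" and win: "seeker_wins_sm \<delta> Y T" and \<delta>: "Field \<delta> \<subseteq> {\<alpha>}"
  shows "openin T Y \<or> closedin T Y"
proof -
  from win obtain \<sigma> where op: "\<forall>\<alpha>\<in>Field \<delta>. \<forall>h. openin T (\<sigma> \<alpha> h)"
    and \<sigma>: "\<forall>U V. (\<forall>\<alpha>\<in>Field \<delta>. U \<alpha> = \<sigma> \<alpha> (restrict (\<lambda>\<gamma>. (U \<gamma>, V \<gamma>)) (underS \<delta> \<alpha>)) \<and>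
       V \<alpha> \<in> {U \<alpha>, topspace T - U \<alpha>}) \<longrightarrow> play_outcome \<delta> T V \<subseteq> Y \<or> play_outcome \<delta> T V \<inter> Y = {}"
    unfolding seeker_wins_sm_def seeker_wins_def by (elim exE conjE)
  have win: "play_outcome \<delta> T V \<subseteq> Y \<or> play_outcome \<delta> T V \<inter> Y = {}"
    if "\<And>\<alpha>. \<alpha> \<in> Field \<delta> \<Longrightarrow> U \<alpha> = \<sigma> \<alpha> (restrict (\<lambda>\<gamma>. (U \<gamma>, V \<gamma>)) (underS \<delta> \<alpha>)) \<and>
       V \<alpha> \<in> {U \<alpha>, topspace T - U \<alpha>}" for U V
    by (rule \<sigma>[rule_format, of U V]) (rule that)
  show ?thesis
  proof (cases "Field \<delta> = {}")
    case True
    with win have "topspace T \<subseteq> Y \<or> topspace T \<inter> Y = {}"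
      by (auto simp: play_outcome_def)
    with Y have "Y = topspace T \<or> Y = {}" by blast
    then show ?thesis by auto
  next
    case False
    with \<delta> have F: "Field \<delta> = {\<alpha>}" by blast
    have "underS \<delta> \<alpha> = {}"
      using underS_Field[of _ \<delta> \<alpha>] F by (auto simp: underS_def Field_def)
    \<comment> \<open>The only move has an empty history, so \<open>G\<close> does not depend on the
      play.\<close>
    define G where "G = \<sigma> \<alpha> (\<lambda>_. undefined)"
    have G: "openin T G" using op F by (simp add: G_def)
    have *: "topspace T \<inter> V \<subseteq> Y \<or> topspace T \<inter> V \<inter> Y = {}" if V: "V \<in> {G, topspace T - G}" for V
    proof -
      have "G = \<sigma> \<alpha> (restrict (\<lambda>\<gamma>. (G, V)) (underS \<delta> \<alpha>))"
        by (simp add: \<open>underS \<delta> \<alpha> = {}\<close> G_def restrict_def)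
      then have "play_outcome \<delta> T (\<lambda>_. V) \<subseteq> Y \<or> play_outcome \<delta> T (\<lambda>_. V) \<inter> Y = {}"
        using V by (intro win[of "\<lambda>_. G"]) (simp add: F)
      then show ?thesis by (simp add: play_outcome_def F)
    qed
    have "G \<subseteq> topspace T" by (rule openin_subset[OF G])
    then have G_or: "G \<subseteq> Y \<or> G \<inter> Y = {}"
      using *[of G] by (simp add: Int_absorb1)
    have "topspace T - G \<subseteq> Y \<or> (topspace T - G) \<inter> Y = {}"
      using *[of "topspace T - G"] by (simp add: Int_absorb1)
    with G_or have "Y = topspace T \<or> Y = G \<or> Y = topspace T - G \<or> Y = {}"
    proof (elim disjE, goal_cases)
      case 1
      then have "Y = topspace T" using Y by blast
      then show ?case by (rule disjI1)
    next
      case 2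
      then have "Y = G" using Y by blast
      then show ?case by simp
    next
      case 3
      then have "Y = topspace T - G" using Y by blast
      then show ?case by simp
    next
      case 4
      then have "Y = {}" using Y by blast
      then show ?case by simp
    qed
    then show ?thesis using G by auto
  qed
qed

text \<open>Equivalently, every dense set is open, i.e. the space is submaximal.\<close>

definition closed_residues :: "'a topology \<Rightarrow> bool" where
  "closed_residues T \<longleftrightarrow> (\<forall>A\<subseteq>topspace T. closedin T (A - T interior_of A))"

text \<open>The Seeker plays the interior of \<open>A\<close> and the complement of the residue. A
  Hider who keeps the interior, or the residue itself, stays inside \<open>A\<close>; otherwise
  every point of \<open>A\<close> has been discarded.\<close>

lemma closed_residues_two_moves:
  assumes "closed_residues T" "A \<subseteq> topspace T"
  obtains G H where "openin T G" "openin T H"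
    "\<And>V V'. V \<in> {G, topspace T - G} \<Longrightarrow> V' \<in> {H, topspace T - H} \<Longrightarrow> V \<inter> V' \<subseteq> A \<or> V \<inter> V' \<inter> A = {}"
proof
  let ?G = "T interior_of A" and ?H = "topspace T - (A - T interior_of A)"
  show "openin T ?G" "openin T ?H"
    using assms by (auto simp: closed_residues_def)
  have "?G \<subseteq> A" by (rule interior_of_subset)
  then show "V \<inter> V' \<subseteq> A \<or> V \<inter> V' \<inter> A = {}"
    if "V \<in> {?G, topspace T - ?G}" "V' \<in> {?H, topspace T - ?H}" for V V'
    using that by auto
qed

lemma seeker_wins_sm_two:
  assumes "closed_residues T" "Y \<subseteq> topspace T"
  shows "seeker_wins_sm (natLeq_on 2) Y T"
proof -
  obtain G H where GH: "openin T G" "openin T H"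
    "\<And>V V'. V \<in> {G, topspace T - G} \<Longrightarrow> V' \<in> {H, topspace T - H} \<Longrightarrow> V \<inter> V' \<subseteq> Y \<or> V \<inter> V' \<inter> Y = {}"
    using closed_residues_two_moves[OF assms] by blast
  have F: "Field (natLeq_on 2) = {0, Suc 0}"
    by (auto simp: Field_natLeq_on)
  show ?thesis
    unfolding seeker_wins_sm_def
  proof (rule seeker_wins_nonadaptive[where A="\<lambda>n. if n = 0 then G else H"])
    fix V assume "\<And>\<alpha>. \<alpha> \<in> Field (natLeq_on 2) \<Longrightarrow>
      V \<alpha> \<in> {if \<alpha> = 0 then G else H, topspace T - (if \<alpha> = 0 then G else H)}"
    from this[of 0] this[of "Suc 0"]
    have "V 0 \<in> {G, topspace T - G}" "V (Suc 0) \<in> {H, topspace T - H}"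
      unfolding F by auto
    then show "play_outcome (natLeq_on 2) T V \<subseteq> Y \<or> play_outcome (natLeq_on 2) T V \<inter> Y = {}"
      using GH(3)[of "V 0" "V (Suc 0)"] unfolding play_outcome_def F by auto
  qed (use GH in auto)
qed

text \<open>Two moves decide membership in one set, so \<open>2 * |\<mu>| = |\<mu>|\<close> moves decide it for a family of
  \<open>|\<mu>|\<close> sets that separates the points.\<close>

lemma seeker_wins_ps_if_closed_residues:
  fixes T :: "'a topology" and \<mu> :: "'b rel"
  assumes "closed_residues T" and inf: "infinite (Field \<mu>)" and le: "|topspace T| \<le>o ctwo ^c \<mu>"
  shows "seeker_wins_ps \<mu> T"
proof -
  have "|topspace T| \<le>o |Func (Field \<mu>) (UNIV :: bool set)|"
    using le by (simp add: cexp_def ctwo_def Field_card_of)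
  then obtain c :: "'a \<Rightarrow> 'b \<Rightarrow> bool"
    where c: "inj_on c (topspace T)" "c ` topspace T \<subseteq> Func (Field \<mu>) UNIV"
    by (auto simp: card_of_ordLeq[symmetric])
  have "|Field \<mu> \<times> (UNIV :: bool set)| =o |Field \<mu>|"
    using inf by (intro card_of_Times_infinite_simps) (auto intro!: ordLess_imp_ordLeq finite_ordLess_infinite2)
  then obtain h where h: "bij_betw h (Field \<mu>) (Field \<mu> \<times> (UNIV :: bool set))"
    using card_of_ordIso ordIso_symmetric by blast
  \<comment> \<open>Since \<open>c\<close> is injective, the sets \<open>S l\<close> with
    \<open>l\<close> in \<open>Field \<mu>\<close> separate the points.\<close>
  define S where "S l = {x \<in> topspace T. c x l}" for l
  have "\<exists>G H. openin T G \<and> openin T H \<and> (\<forall>V V'. V \<in> {G, topspace T - G} \<longrightarrow>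
      V' \<in> {H, topspace T - H} \<longrightarrow> V \<inter> V' \<subseteq> S l \<or> V \<inter> V' \<inter> S l = {})" for l
    using closed_residues_two_moves[OF assms(1), of "S l"] by (metis (no_types, lifting) S_def mem_Collect_eq subsetI)
  then obtain G H where GH: "\<And>l. openin T (G l)" "\<And>l. openin T (H l)"
    "\<And>l V V'. V \<in> {G l, topspace T - G l} \<Longrightarrow> V' \<in> {H l, topspace T - H l} \<Longrightarrow>
       V \<inter> V' \<subseteq> S l \<or> V \<inter> V' \<inter> S l = {}"
    by metis
  \<comment> \<open>Through \<open>h\<close> every \<open>l\<close> owns two moves, at which the two
    sets deciding \<open>S l\<close> are played. They may stand anywhere in the order, as neither
    depends on the history.\<close>
  define A where "A \<alpha> = (if snd (h \<alpha>) then G (fst (h \<alpha>)) else H (fst (h \<alpha>)))" for \<alpha>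
  show ?thesis
    unfolding seeker_wins_ps_def
  proof (rule seeker_wins_nonadaptive[where A=A])
    show "openin T (A \<alpha>)" for \<alpha> by (simp add: A_def GH)
    fix V assume V: "\<And>\<alpha>. \<alpha> \<in> Field \<mu> \<Longrightarrow> V \<alpha> \<in> {A \<alpha>, topspace T - A \<alpha>}"
    let ?W = "play_outcome \<mu> T V"
    have "x = y" if xy: "x \<in> ?W" "y \<in> ?W" for x y
    proof -
      have "c x l = c y l" if l: "l \<in> Field \<mu>" for l
      proof -
        have "\<exists>\<alpha>\<in>Field \<mu>. h \<alpha> = (l, b)" for b
        proof -
          have "(l, b) \<in> h ` Field \<mu>"
            using h l by (simp add: bij_betw_def)
          then show ?thesis by auto
        qed
        then obtain \<alpha> \<alpha>' where \<alpha>: "\<alpha> \<in> Field \<mu>" "h \<alpha> = (l, True)" and \<alpha>': "\<alpha>' \<in> Field \<mu>" "h \<alpha>' = (l, False)"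
          by metis
        have "V \<alpha> \<inter> V \<alpha>' \<subseteq> S l \<or> V \<alpha> \<inter> V \<alpha>' \<inter> S l = {}"
          using V[OF \<alpha>(1)] V[OF \<alpha>'(1)] \<alpha>(2) \<alpha>'(2) by (intro GH(3)) (auto simp: A_def)
        moreover have "{x, y} \<subseteq> V \<alpha> \<inter> V \<alpha>' \<inter> topspace T"
          using xy \<alpha> \<alpha>' by (auto simp: play_outcome_def)
        ultimately show ?thesis by (auto simp: S_def)
      qed
      moreover have "c x \<in> Func (Field \<mu>) UNIV" "c y \<in> Func (Field \<mu>) UNIV"
        using c(2) xy by (auto simp: play_outcome_def)
      ultimately have "c x = c y"
        by (auto simp: Func_def fun_eq_iff)
      then show "x = y"
        using c(1) xy by (auto simp: play_outcome_def inj_on_def)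
    qed
    then have "?W = {} \<or> (\<exists>x. ?W = {x})" by blast
    then show "finite ?W \<and> card ?W \<le> 1" by auto
  qed
qed

section \<open>The exact lengths of both games\<close>

lemma Func_eq_PiE: "Func A B = A \<rightarrow>\<^sub>E B"
  by (auto simp: Func_def PiE_def Pi_def extensional_def)

text \<open>A finite exponent gives a finite power of two. Being infinite is what allows twice
  \<open>clog \<kappa>\<close> moves to fit into \<open>clog \<kappa>\<close> moves.\<close>

lemma infinite_Field_clog:
  assumes "Cinfinite \<kappa>"
  shows "infinite (Field (clog \<kappa>))"
proof
  assume "finite (Field (clog \<kappa>))"
  then have "finite (Func (Field (clog \<kappa>)) (UNIV :: bool set))"
    by (simp add: Func_eq_PiE finite_PiE)
  then have "finite (Field (ctwo ^c clog \<kappa>))"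
    by (simp add: cexp_def ctwo_def Field_card_of)
  moreover have "\<kappa> \<le>o ctwo ^c clog \<kappa>"
    using assms by (intro clog(2)) simp
  ultimately show False
    using cinfinite_mono[of \<kappa> "ctwo ^c clog \<kappa>"] assms unfolding cinfinite_def by simp
qed

text \<open>Upper bound: \<open>\<kappa>\<close> points have codes of length
  \<open>clog \<kappa>\<close>. Lower bound: a win in \<open>\<gamma>\<close> moves bounds
  \<open>\<kappa>\<close> by two to the power \<open>|Field \<gamma>|\<close>, so
  \<open>clog \<kappa>\<close> is at most this cardinal, which is at most \<open>\<gamma>\<close> as
  an ordinal.\<close>

lemma has_ps_clog:
  fixes T :: "'a topology" and \<kappa> :: "'k rel"
  assumes \<kappa>: "Cinfinite \<kappa>" and "|topspace T| =o \<kappa>" and "closed_residues T"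
  shows "has_ps T (clog \<kappa>)"
  unfolding has_ps_def least_ordinal_def
proof (intro conjI allI impI)
  have card: "Card_order \<kappa>" using \<kappa> by simp
  show "Well_order (clog \<kappa>)"
    by (rule card_order_on_well_order_on[OF clog(1)[OF card]])
  show "seeker_wins_ps (clog \<kappa>) T"
    using assms(3) infinite_Field_clog[OF \<kappa>] ordIso_ordLeq_trans[OF assms(2) clog(2)[OF card]]
    by (rule seeker_wins_ps_if_closed_residues)
  fix \<gamma> :: "'k rel" assume \<gamma>: "Well_order \<gamma> \<and> seeker_wins_ps \<gamma> T"
  then have "|topspace T| \<le>o ctwo ^c |Field \<gamma>|"
    by (intro card_le_if_seeker_wins_ps) simp_all
  then have "clog \<kappa> \<le>o |Field \<gamma>|"
    by (intro clog(3)[OF card card_of_Card_order] ordIso_ordLeq_trans[OF ordIso_symmetric[OF assms(2)]])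
  also have "|Field \<gamma>| \<le>o \<gamma>"
    using \<gamma> card_of_least[of "Field \<gamma>" \<gamma>] by auto
  finally show "clog \<kappa> \<le>o \<gamma>" .
qed

text \<open>Here \<open>r\<close> is the ordinal two, on any type. A single set that is neither open
  nor closed already forces two moves, by \<open>clopen_if_single_move\<close>.\<close>

lemma has_sm_two:
  fixes r :: "'b rel"
  assumes r: "Well_order r" "r =o |{0, Suc 0}|"
    and win: "\<And>Z. Z \<subseteq> topspace T \<Longrightarrow> seeker_wins_sm r Z T"
    and Y: "Y \<subseteq> topspace T" "\<not> openin T Y" "\<not> closedin T Y"
  shows "has_sm T r"
  unfolding has_sm_def least_ordinal_def
proof (intro conjI allI impI)
  show "Well_order r" by fact
  fix Z assume "Z \<subseteq> topspace T"
  \<comment> \<open>The lengths at which the Seeker wins for \<open>Z\<close>; \<open>r\<close> is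
    one of them, so there is a least one.\<close>
  define \<D> where "\<D> = {\<delta> :: 'b rel. Well_order \<delta> \<and> seeker_wins_sm \<delta> Z T}"
  have "r \<in> \<D>"
    using r(1) win[OF \<open>Z \<subseteq> _\<close>] by (simp add: \<D>_def)
  then have "\<exists>\<delta>\<in>\<D>. \<forall>\<gamma>\<in>\<D>. \<delta> \<le>o \<gamma>"
    by (intro exists_minim_Well_order) (auto simp: \<D>_def)
  then obtain \<delta> where \<delta>: "\<delta> \<in> \<D>" "\<forall>\<gamma>\<in>\<D>. \<delta> \<le>o \<gamma>"
    by (elim bexE)
  show "\<exists>\<delta>::'b rel. has_sm_in Z T \<delta> \<and> \<delta> \<le>o r"
  proof (rule exI[of _ \<delta>], rule conjI)
    show "has_sm_in Z T \<delta>"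
      using \<delta> by (simp add: has_sm_in_def least_ordinal_def \<D>_def)
    show "\<delta> \<le>o r"
      using \<delta>(2) \<open>r \<in> \<D>\<close> by (rule bspec)
  qed
next
  fix \<gamma> :: "'b rel"
  assume "Well_order \<gamma> \<and> (\<forall>Y\<subseteq>topspace T. \<exists>\<delta>::'b rel. has_sm_in Y T \<delta> \<and> \<delta> \<le>o \<gamma>)"
  then have "\<exists>\<delta>::'b rel. has_sm_in Y T \<delta> \<and> \<delta> \<le>o \<gamma>"
    using Y(1) by simp
  then obtain \<delta> :: "'b rel" where sm: "has_sm_in Y T \<delta>" and le: "\<delta> \<le>o \<gamma>"
    by (elim exE conjE)
  from sm have \<delta>: "Well_order \<delta>" "seeker_wins_sm \<delta> Y T"
    unfolding has_sm_in_def least_ordinal_def by simp_all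
  have "Field \<delta> \<noteq> {}" "\<And>\<alpha>. Field \<delta> \<noteq> {\<alpha>}"
    using clopen_if_single_move[OF Y(1) \<delta>(2)] Y by auto
  then obtain a b where ab: "a \<in> Field \<delta>" "b \<in> Field \<delta>" "a \<noteq> b" by blast
  have "|{0, Suc 0}| \<le>o |Field \<delta>|"
    by (rule card_of_ordLeqI[where f="\<lambda>n. if n = 0 then a else b"]) (use ab in \<open>auto simp: inj_on_def\<close>)
  also have "|Field \<delta>| \<le>o \<delta>"
    using \<delta>(1) card_of_least[of "Field \<delta>" \<delta>] by auto
  also note le
  finally have "|{0, Suc 0}| \<le>o \<gamma>" .
  with r(2) show "r \<le>o \<gamma>" by (rule ordIso_ordLeq_trans)
qed

lemma natLeq_on_two_ordIso: "natLeq_on 2 =o |{0, Suc 0}|"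
proof -
  have "Field (natLeq_on 2) = {0, Suc 0}"
    by (auto simp: Field_natLeq_on)
  then have "|{0, Suc 0}| =o natLeq_on 2"
    using card_of_Field_ordIso[OF natLeq_on_Card_order[of 2]] by (simp only:)
  then show ?thesis by (rule ordIso_symmetric)
qed


section \<open>The space\<close>

definition basic_box :: "'i set \<Rightarrow> 'i set \<Rightarrow> 'i set \<Rightarrow> ('i \<Rightarrow> bool) set" where
  "basic_box I P Q = {f \<in> topspace (cantor_cube I). (\<forall>i\<in>P. f i) \<and> (\<forall>i\<in>Q. \<not> f i)}"

lemma topspace_cantor_cube: "topspace (cantor_cube I) = I \<rightarrow>\<^sub>E UNIV"
  by (simp add: cantor_cube_def)

text \<open>A box is the intersection of finitely many preimages of points of the discrete space
  under projections.\<close>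

lemma clopen_basic_box:
  assumes "(P, Q) \<in> disjoint_pairs I"
  shows "openin (cantor_cube I) (basic_box I P Q)" "closedin (cantor_cube I) (basic_box I P Q)"
proof -
  define S where "S b i = {f \<in> topspace (cantor_cube I). f i \<in> {b}}" for b i
  have S: "openin (cantor_cube I) (S b i) \<and> closedin (cantor_cube I) (S b i)" if "i \<in> I" for b i
  proof -
    have cont: "continuous_map (cantor_cube I) (discrete_topology UNIV) (\<lambda>f. f i)"
      unfolding cantor_cube_def using that by (rule continuous_map_product_projection)
    show ?thesis
      unfolding S_def
      by (intro conjI openin_continuous_map_preimage[OF cont] closedin_continuous_map_preimage[OF cont]) simp_all
  qed
  \<comment> \<open>The whole cube is inserted to keep the family nonempty when \<open>P\<close> and
    \<open>Q\<close> are both empty.\<close>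
  define \<F> where "\<F> = insert (topspace (cantor_cube I)) (S True ` P \<union> S False ` Q)"
  have "f \<in> \<Inter>\<F> \<longleftrightarrow> f \<in> basic_box I P Q" for f
    unfolding \<F>_def Inter_insert Inter_Un_distrib by (simp add: S_def basic_box_def) blast
  then have basic_box: "basic_box I P Q = \<Inter>\<F>" by blast
  have PQ: "finite P" "finite Q" "P \<subseteq> I" "Q \<subseteq> I"
    using assms by (simp_all add: disjoint_pairs_def)
  have F: "openin (cantor_cube I) A \<and> closedin (cantor_cube I) A" if A: "A \<in> \<F>" for A
  proof -
    consider "A = topspace (cantor_cube I)" | b i where "i \<in> I" "A = S b i"
      using A PQ(3,4) unfolding \<F>_def by blast
    then show ?thesis using S by cases simp_all
  qed
  have "finite \<F>" "\<F> \<noteq> {}"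
    using PQ by (simp_all add: \<F>_def)
  then show "openin (cantor_cube I) (basic_box I P Q)" "closedin (cantor_cube I) (basic_box I P Q)"
    unfolding basic_box using F by (simp_all add: openin_Inter closedin_Inter)
qed

text \<open>A basic open set of the product restricts finitely many coordinates. Fixing these to the
  values of \<open>f\<close> gives a box inside it.\<close>

lemma cantor_cube_base:
  assumes "openin (cantor_cube I) U" "f \<in> U"
  obtains P Q where "(P, Q) \<in> disjoint_pairs I" "f \<in> basic_box I P Q" "basic_box I P Q \<subseteq> U"
proof -
  have "\<exists>S. finite {i \<in> I. S i \<noteq> UNIV} \<and> f \<in> Pi\<^sub>E I S \<and> Pi\<^sub>E I S \<subseteq> U"
    using assms by (auto simp: cantor_cube_def openin_product_topology_alt)
  then obtain S where S: "finite {i \<in> I. S i \<noteq> UNIV}" "f \<in> Pi\<^sub>E I S" "Pi\<^sub>E I S \<subseteq> U"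
    by (elim exE conjE)
  define P where "P = {i \<in> I. S i \<noteq> UNIV \<and> f i}"
  define Q where "Q = {i \<in> I. S i \<noteq> UNIV \<and> \<not> f i}"
  show thesis
  proof
    show "(P, Q) \<in> disjoint_pairs I"
      using S(1) by (auto simp: disjoint_pairs_def P_def Q_def intro: rev_finite_subset)
    show "f \<in> basic_box I P Q"
      using S(2) by (auto simp: basic_box_def P_def Q_def topspace_cantor_cube PiE_def)
    have "basic_box I P Q \<subseteq> Pi\<^sub>E I S"
    proof
      fix g assume g: "g \<in> basic_box I P Q"
      show "g \<in> Pi\<^sub>E I S"
      proof (rule PiE_I)
        show "g i \<in> S i" if "i \<in> I" for i
        proof (cases "S i = UNIV")
          case False
          then have "g i = f i"
            using g that by (auto simp: basic_box_def P_def Q_def)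
          then show ?thesis using PiE_mem[OF S(2) that] by simp
        qed simp
        show "g i = undefined" if "i \<notin> I" for i
          using g that by (auto simp: basic_box_def topspace_cantor_cube PiE_def extensional_def)
      qed
    qed
    then show "basic_box I P Q \<subseteq> U" using S(3) by (rule order_trans)
  qed
qed

lemma zero_dimensional_cantor_cube: "zero_dimensional (cantor_cube I)"
  unfolding zero_dimensional_iff_dim_le dimension_le_0_neighbourhood_base_of_clopen neighbourhood_base_of
proof (intro allI impI, elim conjE)
  fix W f assume "openin (cantor_cube I) W" "f \<in> W"
  then obtain P Q where "(P, Q) \<in> disjoint_pairs I" "f \<in> basic_box I P Q" "basic_box I P Q \<subseteq> W"
    by (rule cantor_cube_base)
  then show "\<exists>U V. openin (cantor_cube I) U \<and> (closedin (cantor_cube I) V \<and> openin (cantor_cube I) V) \<and>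
      f \<in> U \<and> U \<subseteq> V \<and> V \<subseteq> W"
    by (intro exI[of _ "basic_box I P Q"] conjI clopen_basic_box order_refl)
qed

section \<open>The dense subspace given by a closing family\<close>

context closing_family
begin

text \<open>The family read pointwise: coordinate \<open>i\<close> records membership in
  \<open>B i\<close>. Off \<open>I\<close> the value is \<open>undefined\<close>, as for all points
  of the cube.\<close>

definition pt :: "'a \<Rightarrow> 'i \<Rightarrow> bool" where "pt x = (\<lambda>i\<in>I. x \<in> B i)"

definition T :: "('i \<Rightarrow> bool) topology" where "T = subtopology (cantor_cube I) (pt ` K)"

lemma pt_in_cube: "pt x \<in> topspace (cantor_cube I)"
  by (simp add: topspace_cantor_cube pt_def)

lemma topspace_T: "topspace T = pt ` K"
  using pt_in_cube by (auto simp: T_def)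

lemma J_subset: "N \<in> J \<Longrightarrow> N \<subseteq> K"
  using ideal_onD(1)[OF ideal] by auto

lemma finite_in_J: "finite F \<Longrightarrow> F \<subseteq> K \<Longrightarrow> F \<in> J"
  by (intro small finite_ordLess_infinite2 infinite_K)

text \<open>For distinct \<open>x\<close> and \<open>y\<close>, \<open>closing\<close> applied to
  \<open>{y}\<close> yields a coordinate that is true at \<open>x\<close> and false at
  \<open>y\<close>.\<close>

lemma inj_pt: "inj_on pt K"
proof (rule inj_onI)
  fix x y assume xy: "x \<in> K" "y \<in> K" "pt x = pt y"
  have "{y} \<in> J" using xy by (intro finite_in_J) auto
  then obtain i where i: "i \<in> I" "x \<in> B i" "B i \<inter> {y} \<subseteq> {x}"
    using closing[of "{y}" x] xy by auto
  have "pt x i = pt y i" using xy by simp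
  then have "y \<in> B i" using i by (simp add: pt_def)
  then show "x = y" using i by auto
qed

text \<open>This is the dictionary by which open sets of \<open>T\<close> are studied through
  cells.\<close>

lemma pt_in_basic_box:
  assumes "(P, Q) \<in> disjoint_pairs I" "x \<in> K"
  shows "pt x \<in> basic_box I P Q \<longleftrightarrow> x \<in> cell K B P Q"
proof -
  have "pt x i \<longleftrightarrow> x \<in> B i" if "i \<in> P \<union> Q" for i
    using assms that by (auto simp: pt_def disjoint_pairs_def)
  then show ?thesis
    using assms(2) pt_in_cube by (simp add: basic_box_def cell_def)
qed

lemma cell_subset: "cell K B P Q \<subseteq> K"
  by (auto simp: cell_def)

lemma openin_cell:
  assumes "(P, Q) \<in> disjoint_pairs I"
  shows "openin T (pt ` cell K B P Q)"
proof -
  have "pt ` cell K B P Q = basic_box I P Q \<inter> pt ` K"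
    using pt_in_basic_box[OF assms] cell_subset[of P Q] by auto
  then show ?thesis
    using clopen_basic_box(1)[OF assms] by (auto simp: T_def openin_subtopology)
qed

lemma T_base:
  assumes "openin T U" "u \<in> U"
  obtains P Q where "(P, Q) \<in> disjoint_pairs I" "u \<in> pt ` cell K B P Q" "pt ` cell K B P Q \<subseteq> U"
proof -
  obtain W where W: "openin (cantor_cube I) W" "U = W \<inter> pt ` K"
    using assms(1) by (auto simp: T_def openin_subtopology)
  obtain x where x: "x \<in> K" "u = pt x" "pt x \<in> W"
    using assms(2) W(2) by auto
  from cantor_cube_base[OF W(1) x(3)] obtain P Q
    where PQ: "(P, Q) \<in> disjoint_pairs I" "pt x \<in> basic_box I P Q" "basic_box I P Q \<subseteq> W"
    by blast
  show thesis
  proof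
    show "u \<in> pt ` cell K B P Q"
      using PQ x pt_in_basic_box by auto
    show "pt ` cell K B P Q \<subseteq> U"
      using PQ pt_in_basic_box[OF PQ(1)] cell_subset[of P Q] W(2) by auto
  qed fact
qed

text \<open>\<open>J\<close> contains every subset of \<open>K\<close> of smaller size, but no
  cell.\<close>

lemma card_le_cell:
  assumes "(P, Q) \<in> disjoint_pairs I"
  shows "|K| \<le>o |cell K B P Q|"
proof -
  have "\<not> |K| \<le>o |cell K B P Q| \<Longrightarrow> |cell K B P Q| <o |K|"
    by (simp only: not_ordLeq_iff_ordLess[OF card_of_Well_order card_of_Well_order])
  then show ?thesis
    using small[OF cell_subset] cell_notin[OF assms] by metis
qed

lemma card_le_open:
  assumes "openin T U" "U \<noteq> {}"
  shows "|K| \<le>o |U|"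
proof -
  obtain u where "u \<in> U" using assms(2) by auto
  from T_base[OF assms(1) this] obtain P Q
    where PQ: "(P, Q) \<in> disjoint_pairs I" "pt ` cell K B P Q \<subseteq> U" by metis
  have "|cell K B P Q| \<le>o |U|"
    using inj_on_subset[OF inj_pt cell_subset] PQ(2) by (intro card_of_ordLeqI[where f=pt]) auto
  with card_le_cell[OF PQ(1)] show ?thesis by (rule ordLeq_transitive)
qed

lemma card_topspace: "|topspace T| =o |K|"
  using card_of_ordIso inj_pt ordIso_symmetric by (metis bij_betw_imageI topspace_T)

text \<open>By \<open>closing\<close>, a point outside \<open>N\<close> has a neighbourhood, given
  by some \<open>B i\<close>, that misses \<open>N\<close>.\<close>

lemma closedin_if_in_J:
  assumes "N \<in> J"
  shows "closedin T (pt ` N)"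
proof -
  have "openin T (topspace T - pt ` N)"
  proof (subst openin_subopen, intro ballI)
    fix u assume "u \<in> topspace T - pt ` N"
    then obtain x where x: "x \<in> K" "u = pt x" "x \<notin> N"
      by (auto simp: topspace_T)
    obtain i where i: "i \<in> I" "x \<in> B i" "B i \<inter> N \<subseteq> {x}"
      using closing[OF assms x(1)] by auto
    have dp: "({i}, {}) \<in> disjoint_pairs I"
      using i by (simp add: disjoint_pairs_def)
    have "u \<in> pt ` cell K B {i} {}"
      using x i by (auto simp: cell_def)
    moreover have "pt ` cell K B {i} {} \<subseteq> topspace T - pt ` N"
    proof -
      have "cell K B {i} {} \<subseteq> K - N"
        using i(3) x(3) by (auto simp: cell_def)
      then show ?thesis
        using inj_on_image_set_diff[OF inj_pt _ J_subset[OF assms], of K] by (auto simp: topspace_T)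
    qed
    ultimately show "\<exists>V. openin T V \<and> u \<in> V \<and> V \<subseteq> topspace T - pt ` N"
      using openin_cell[OF dp] by (intro exI conjI)
  qed
  moreover have "pt ` N \<subseteq> topspace T"
    using J_subset[OF assms] by (auto simp: topspace_T)
  ultimately show ?thesis by (simp add: closedin_def)
qed

text \<open>If \<open>Y\<close> were outside \<open>J\<close>, some cell would lie in
  \<open>Y\<close> up to a set of \<open>J\<close>. That set is closed, so removing it from the cell
  leaves an open subset of \<open>Y\<close>, which is nonempty because the cell is not in
  \<open>J\<close>.\<close>

lemma in_J_if_interior_empty:
  assumes Y: "Y \<subseteq> K" and int: "T interior_of (pt ` Y) = {}"
  shows "Y \<in> J"
proof (rule ccontr)
  assume "Y \<notin> J"
  then obtain P Q where PQ: "(P, Q) \<in> disjoint_pairs I" "cell K B P Q - Y \<in> J"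
    using cell_dense[OF Y] by auto
  let ?C = "cell K B P Q"
  have "openin T (pt ` ?C - pt ` (?C - Y))"
    by (intro openin_diff openin_cell closedin_if_in_J PQ)
  moreover have "pt ` ?C - pt ` (?C - Y) = pt ` (?C \<inter> Y)"
    using inj_on_image_set_diff[OF inj_pt, of ?C "?C - Y"] cell_subset[of P Q]
    by (auto simp: Diff_Diff_Int)
  ultimately have "pt ` (?C \<inter> Y) \<subseteq> T interior_of (pt ` Y)"
    by (intro interior_of_maximal) auto
  then have "?C \<inter> Y = {}" using int by simp
  then have "?C - Y = ?C" by auto
  then show False using PQ cell_notin by simp
qed

text \<open>An open subset of the residue would lie in the interior that was removed. So the residue
  has empty interior, comes from a set of \<open>J\<close>, and is closed.\<close>

lemma closed_residues_T: "closed_residues T"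
  unfolding closed_residues_def
proof (intro allI impI)
  fix A assume "A \<subseteq> topspace T"
  then have "A - T interior_of A \<subseteq> pt ` K" by (auto simp: topspace_T)
  then obtain Y where Y: "Y \<subseteq> K" "A - T interior_of A = pt ` Y"
    by (auto simp: subset_image_iff)
  have "T interior_of (pt ` Y) \<subseteq> T interior_of A"
    using Y(2) by (intro interior_of_mono) auto
  moreover have "T interior_of (pt ` Y) \<subseteq> pt ` Y" by (rule interior_of_subset)
  ultimately have "T interior_of (pt ` Y) = {}" using Y(2) by auto
  then show "closedin T (A - T interior_of A)"
    unfolding Y(2) by (intro closedin_if_in_J in_J_if_interior_empty Y(1))
qed

text \<open>Every box contains the image of a cell, and cells are nonempty because the empty set is
  in \<open>J\<close>.\<close>

lemma dense: "cantor_cube I closure_of (pt ` K) = topspace (cantor_cube I)"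
  unfolding dense_intersects_open
proof (intro allI impI, elim conjE)
  fix U assume "openin (cantor_cube I) U" "U \<noteq> {}"
  then obtain f where "f \<in> U" by auto
  with \<open>openin _ U\<close> obtain P Q where PQ: "(P, Q) \<in> disjoint_pairs I" "basic_box I P Q \<subseteq> U"
    by (rule cantor_cube_base)
  have "cell K B P Q \<noteq> {}"
    using cell_notin[OF PQ(1)] ideal_onD(2)[OF ideal] by auto
  then obtain x where "x \<in> cell K B P Q" by auto
  then have "x \<in> K" "pt x \<in> basic_box I P Q"
    using cell_subset[of P Q] pt_in_basic_box[OF PQ(1)] by auto
  then show "pt ` K \<inter> U \<noteq> {}" using PQ(2) by auto
qed

lemma dispersion_character_T: "dispersion_character T =o |K|"
proof -
  have ne: "topspace T \<noteq> {}" using infinite_K by (auto simp: topspace_T)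
  obtain U where U: "openin T U" "U \<noteq> {}" "dispersion_character T = |U|"
    using dispersion_character(1)[OF ne] by auto
  have "|U| \<le>o |topspace T|"
    using openin_subset[OF U(1)] by (rule card_of_mono1)
  then have "|U| \<le>o |K|"
    using card_topspace by (rule ordLeq_ordIso_trans)
  then show ?thesis
    using card_le_open[OF U(1,2)] unfolding U(3) ordIso_iff_ordLeq by (rule conjI)
qed

lemma open_not_singleton: "\<not> openin T {u}"
proof
  assume "openin T {u}"
  then have "|K| \<le>o |{u}|" by (rule card_le_open) simp
  then show False
    using card_of_ordLeq_infinite infinite_K by fast
qed

text \<open>In disjoint nonempty open sets \<open>C\<close> and \<open>D\<close>, exchange a point
  \<open>a\<close> of \<open>C\<close> for a point \<open>d\<close> of \<open>D\<close>. If the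
  result were open, \<open>{d}\<close> would be open; if it were closed, \<open>{a}\<close> would be
  open. But nonempty open sets are infinite.\<close>

lemma ex_not_open_not_closed: "\<exists>Y\<subseteq>topspace T. \<not> openin T Y \<and> \<not> closedin T Y"
proof -
  obtain x where "x \<in> K" using infinite_K by (auto dest: infinite_imp_nonempty)
  then obtain i where "i \<in> I"
    using closing[OF ideal_onD(2)[OF ideal]] by auto
  then have dp: "({i}, {}) \<in> disjoint_pairs I" "({}, {i}) \<in> disjoint_pairs I"
    by (auto simp: disjoint_pairs_def)
  define C where "C = pt ` cell K B {i} {}"
  define D where "D = pt ` cell K B {} {i}"
  have op: "openin T C" "openin T D"
    unfolding C_def D_def by (intro openin_cell dp)+
  have sub: "C \<subseteq> topspace T" "D \<subseteq> topspace T"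
    using op by (auto dest: openin_subset)
  have disj: "C \<inter> D = {}"
  proof -
    have "cell K B {i} {} \<inter> cell K B {} {i} = {}"
      by (auto simp: cell_def)
    then show ?thesis
      using inj_on_image_Int[OF inj_pt cell_subset cell_subset, of "{i}" "{}" "{}" "{i}"]
      by (simp add: C_def D_def)
  qed
  have "C \<noteq> {}" "D \<noteq> {}"
    using cell_notin[OF dp(1)] cell_notin[OF dp(2)] ideal_onD(2)[OF ideal] by (auto simp: C_def D_def)
  then obtain a d where ad: "a \<in> C" "d \<in> D" by auto
  define Y where "Y = insert d (C - {a})"
  have YD: "Y \<inter> D = {d}"
    using ad disj unfolding Y_def by auto
  have CY: "C - Y = {a}"
    using ad disj unfolding Y_def by auto
  have "\<not> openin T Y"
  proof
    assume "openin T Y"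
    from openin_Int[OF this op(2)] show False
      unfolding YD using open_not_singleton by simp
  qed
  moreover have "\<not> closedin T Y"
  proof
    assume "closedin T Y"
    from openin_diff[OF op(1) this] show False
      unfolding CY using open_not_singleton by simp
  qed
  moreover have "Y \<subseteq> topspace T"
    using sub ad unfolding Y_def by blast
  ultimately show ?thesis by (intro exI[of _ Y] conjI)
qed

end

theorem corollary5p8:
  fixes \<kappa> :: "'k rel"
  assumes "Cinfinite \<kappa>"
  shows "\<exists>X. X \<subseteq> topspace (cantor_cube (Field (ctwo ^c \<kappa>))) \<and>
    cantor_cube (Field (ctwo ^c \<kappa>)) closure_of X = topspace (cantor_cube (Field (ctwo ^c \<kappa>))) \<and>
    (let T = subtopology (cantor_cube (Field (ctwo ^c \<kappa>))) X in
       zero_dimensional T \<and> Hausdorff_space T \<and>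
       |X| =o \<kappa> \<and> dispersion_character T =o \<kappa> \<and>
       has_ps T (clog \<kappa>) \<and> has_sm T (natLeq_on 2))"
proof -
  have inf: "infinite (Field \<kappa>)" and card: "Card_order \<kappa>"
    using assms by (simp_all add: cinfinite_def)
  \<comment> \<open>The cube of the theorem is indexed by the very functions that index the closing
    family.\<close>
  have Field: "Field (ctwo ^c \<kappa>) = Func (Field \<kappa>) (UNIV :: bool set)"
    by (simp add: cexp_def ctwo_def Field_card_of)
  obtain B J where "closing_family (Field \<kappa>) (Func (Field \<kappa>) (UNIV :: bool set)) B J"
    using ex_closing_family[OF inf] by (elim exE)
  then interpret closing_family "Field \<kappa>" "Func (Field \<kappa>) (UNIV :: bool set)" B J .
  let ?X = "pt ` Field \<kappa>"
  have \<kappa>: "|Field \<kappa>| =o \<kappa>" using card by (rule card_of_Field_ordIso)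
  have X: "|topspace T| =o \<kappa>" using card_topspace \<kappa> by (rule ordIso_transitive)
  have "zero_dimensional T"
    using zero_dimensional_cantor_cube dimension_le_subtopology
    unfolding T_def zero_dimensional_iff_dim_le by blast
  moreover have "Hausdorff_space T"
    unfolding T_def cantor_cube_def
    by (intro Hausdorff_space_subtopology) (simp add: Hausdorff_space_product_topology)
  moreover have "|?X| =o \<kappa>" using X by (simp only: topspace_T)
  moreover have "dispersion_character T =o \<kappa>"
    using dispersion_character_T \<kappa> by (rule ordIso_transitive)
  moreover have "has_ps T (clog \<kappa>)"
    using assms X closed_residues_T by (rule has_ps_clog)
  moreover have "has_sm T (natLeq_on 2)"
    using ex_not_open_not_closed
      has_sm_two[OF natLeq_on_Well_order natLeq_on_two_ordIso seeker_wins_sm_two[OF closed_residues_T]]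
    by (elim exE conjE)
  moreover have "?X \<subseteq> topspace (cantor_cube (Func (Field \<kappa>) UNIV))"
    using pt_in_cube by auto
  ultimately show ?thesis
    unfolding Field Let_def using dense by (intro exI[of _ ?X] conjI) (simp_all only: T_def)
qed

end
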